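(* For $k\ge0$ let $\bar H_k\in\mathbb{R}^{p\times p}$ be (random) symmetric matrices with symmetric indefinite factorizations $\bar H_k=P_k^TL_kB_kL_k^TP_k$, and suppose $\bar H_k\to H(\theta^* )$ a.s., where $H(\theta^* )$ is positive definite. Let $B_k=Q_k\Lambda_kQ_k^T$ be an eigendecomposition, $\Lambda_k=\mathrm{diag}(\lambda_{k1},\dots,\lambda_{kp})$, and with a constant threshold $\underline{\tau}$ set $\bar\Lambda_k=\mathrm{diag}(\max\{\underline{\tau},|\lambda_{kj}|\})_{j=1}^p$ and $\bar{\bar H}_k=P_k^TL_kQ_k\bar\Lambda_kQ_k^TL_k^TP_k$. If $0<\underline{\tau}\le\lambda_{\min}(H(\theta^* ))/(2\bar\sigma^2)$, then there exists $K_1$ such that $\bar{\bar H}_k=\bar H_k$ for all $k>K_1$.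
   Context: In the factorization: $P_k$ permutation, $B_k$ block diagonal with symmetric $1\times1$ or $2\times2$ blocks, $L_k$ unit lower triangular with entries bounded in magnitude by a fixed constant independent of $k$. $\bar\sigma$ is a constant, independent of $k$ and the sample path, with $\sigma_{\max}(L_k)\le\bar\sigma$ for all $k$ (largest singular value). $H(\theta^* )$ is the Hessian of the loss at its minimizer $\theta^*$ and $\bar H_k$ is the running Hessian estimate of a second-order simultaneous-perturbation stochastic approximation algorithm. *)

theory Defs
  imports "HOL-Probability.Probability"
begin

text \<open>Square matrices are of type real^'p^'p; the index type 'p is finite and
linearly ordered (to speak of lower triangular / block structure).\<close>

definition symmetric_mat :: "real^'n^'n \<Rightarrow> bool" where
  "symmetric_mat A \<longleftrightarrow> transpose A = A"

definition permutation_mat :: "real^'n^'n \<Rightarrow> bool" where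
  "permutation_mat P \<longleftrightarrow>
     (\<exists>\<sigma>. \<sigma> permutes (UNIV::'n set) \<and> P = (\<chi> i j. if \<sigma> i = j then 1 else 0))"

definition unit_lower_triangular :: "real^('n::{finite,linorder})^('n::{finite,linorder}) \<Rightarrow> bool" where
  "unit_lower_triangular L \<longleftrightarrow> (\<forall>i. L$i$i = 1) \<and> (\<forall>i j. i < j \<longrightarrow> L$i$j = 0)"

text \<open>Block diagonal with symmetric 1x1 or 2x2 diagonal blocks: the index set is cut
into consecutive blocks (fibres of a monotone labelling) of size at most 2, and all
nonzero entries lie inside the diagonal blocks; the matrix is symmetric.\<close>
definition block_diag_12 :: "real^('n::{finite,linorder})^('n::{finite,linorder}) \<Rightarrow> bool" where
  "block_diag_12 B \<longleftrightarrow> symmetric_mat B \<and>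
     (\<exists>blk::'n \<Rightarrow> nat. mono blk \<and> (\<forall>m. card {i. blk i = m} \<le> 2) \<and>
        (\<forall>i j. B$i$j \<noteq> 0 \<longrightarrow> blk i = blk j))"

definition diag_mat :: "real^'n \<Rightarrow> real^'n^'n" where
  "diag_mat d = (\<chi> i j. if i = j then d$i else 0)"

definition positive_definite :: "real^'n^'n \<Rightarrow> bool" where
  "positive_definite A \<longleftrightarrow> symmetric_mat A \<and> (\<forall>x. x \<noteq> 0 \<longrightarrow> x \<bullet> (A *v x) > 0)"

definition eigenvalues_mat :: "real^'n^'n \<Rightarrow> real set" where
  "eigenvalues_mat A = {l. \<exists>v. v \<noteq> 0 \<and> A *v v = l *\<^sub>R v}"

definition lambda_min :: "real^'n^'n \<Rightarrow> real" where
  "lambda_min A = Min (eigenvalues_mat A)"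

text \<open>Largest singular value = spectral (operator) norm.\<close>
definition sigma_max :: "real^'n^'n \<Rightarrow> real" where
  "sigma_max A = onorm (\<lambda>x. A *v x)"

end

(* For large k the quadratic form of Hbar_k is bounded below by lambda_min(Hstar)/2 |z|^2,
   since Hbar_k -> Hstar. Every eigenvalue lambda_kj of B_k is the value of this form at the vector z
   with L_k^T P_k z = Q_k e_j, a unit vector; as |L_k^T y| <= sigma_max L_k |y| <= sigmabar |y|
   and P_k is orthogonal, |z| >= 1/sigmabar. Hence lambda_kj >= lambda_min(Hstar) / (2 sigmabar^2)
   >= tau, and the modification max(tau, |lambda_kj|) leaves every eigenvalue unchanged. *)
theory Submission
  imports Defs
begin

lemma inner_matrix_vector_transpose:
  "(x::real^'m) \<bullet> (A *v y) = (transpose A *v x) \<bullet> y"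
  by (metis dot_lmul_matrix transpose_matrix_vector)

lemma symmetric_mat_inner_commute:
  "symmetric_mat A \<Longrightarrow> (A *v x) \<bullet> (y::real^'n) = x \<bullet> (A *v y)"
  unfolding symmetric_mat_def by (metis inner_matrix_vector_transpose)

lemma inner_congruence:
  "(z::real^'n) \<bullet> ((transpose M ** A ** M) *v z) = (M *v z) \<bullet> (A *v (M *v z))"
proof -
  have "(transpose M ** A ** M) *v z = transpose M *v (A *v (M *v z))"
    by (simp only: matrix_vector_mul_assoc matrix_mul_assoc)
  then show ?thesis by (simp only: inner_matrix_vector_transpose transpose_transpose)
qed

lemma orthogonal_matrix_norm: "orthogonal_matrix (Q::real^'n^'n) \<Longrightarrow> norm (Q *v x) = norm x"
  using orthogonal_transformation_matrix[of "\<lambda>x. Q *v x"]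
  by (simp add: orthogonal_transformation_norm)

lemma permutation_mat_imp_orthogonal:
  assumes "permutation_mat (P::real^'n^'n)"
  shows "orthogonal_matrix P"
proof -
  obtain s where s: "s permutes UNIV" and P: "P = (\<chi> i j. if s i = j then 1 else 0)"
    using assms unfolding permutation_mat_def by blast
  have "(P ** transpose P)$i$k = mat 1 $i$k" for i k
  proof -
    have "(P ** transpose P)$i$k = (\<Sum>j\<in>UNIV. (if s i = j then 1 else 0) * (if s k = j then 1 else 0::real))"
      by (simp add: P matrix_matrix_mult_def transpose_def)
    also have "\<dots> = (\<Sum>j\<in>UNIV. if s i = j then (if s k = j then 1 else 0) else 0)"
      by (rule sum.cong) auto
    also have "\<dots> = (if s k = s i then 1 else 0)" by (simp add: sum.delta)
    also have "\<dots> = mat 1 $i$k"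
      using permutes_inj[OF s] by (simp add: mat_def inj_eq)
    finally show ?thesis .
  qed
  then have "P ** transpose P = mat 1" by (simp add: vec_eq_iff)
  then show ?thesis
    using orthogonal_matrix[of "transpose P"] by (simp add: orthogonal_matrix_def)
qed

lemma unit_lower_triangular_transpose_kernel:
  fixes L :: "real^('n::{finite,linorder})^('n::{finite,linorder})"
  assumes L: "unit_lower_triangular L" and "transpose L *v v = 0"
  shows "v = 0"
proof (rule ccontr)
  assume "v \<noteq> 0"
  define S where "S = {i. v$i \<noteq> 0}"
  \<comment> \<open>At the last index of the support of v, the unit upper triangular L^T reproduces v.\<close>
  define i where "i = Max S"
  have "S \<noteq> {}" using \<open>v \<noteq> 0\<close> by (auto simp: S_def vec_eq_iff)
  then have "v$i \<noteq> 0" unfolding i_def using Max_in[of S] by (auto simp: S_def)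
  have above: "v$j = 0" if "i < j" for j
  proof (rule ccontr)
    assume "v$j \<noteq> 0"
    then have "j \<le> i" unfolding i_def by (intro Max_ge) (auto simp: S_def)
    then show False using that by simp
  qed
  have "L$j$i * v$j = 0" if "j \<noteq> i" for j
    using L above[of j] that by (cases "j < i") (auto simp: unit_lower_triangular_def)
  then have "(\<Sum>j\<in>UNIV-{i}. L$j$i * v$j) = 0" by (intro sum.neutral) auto
  moreover have "(transpose L *v v)$i = L$i$i * v$i + (\<Sum>j\<in>UNIV-{i}. L$j$i * v$j)"
    by (simp add: vector_matrix_mult_def mult.commute sum.remove)
  ultimately have "(transpose L *v v)$i = v$i" using L by (simp add: unit_lower_triangular_def)
  then show False using assms(2) \<open>v$i \<noteq> 0\<close> by simp
qed

lemma unit_lower_triangular_transpose_surj: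
  fixes L :: "real^('n::{finite,linorder})^('n::{finite,linorder})"
  assumes "unit_lower_triangular L"
  shows "surj ((*v) (transpose L))"
proof -
  have "inj ((*v) (transpose L))"
    using unit_lower_triangular_transpose_kernel[OF assms]
    by (simp add: linear_injective_0[OF matrix_vector_mul_linear])
  then show ?thesis by (rule linear_injective_imp_surjective[OF matrix_vector_mul_linear _ refl])
qed

lemma norm_transpose_mult_le_sigma_max:
  fixes A :: "real^'n^'n"
  shows "norm (transpose A *v w) \<le> sigma_max A * norm w"
proof -
  let ?y = "transpose A *v w"
  have "(norm ?y)\<^sup>2 = w \<bullet> (A *v ?y)"
    by (metis inner_matrix_vector_transpose power2_norm_eq_inner)
  also have "\<dots> \<le> norm w * norm (A *v ?y)" by (rule Cauchy_Schwarz_ineq2[THEN abs_le_D1])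
  also have "\<dots> \<le> norm w * (sigma_max A * norm ?y)"
    unfolding sigma_max_def by (intro mult_left_mono onorm) auto
  finally have "norm ?y * norm ?y \<le> (sigma_max A * norm w) * norm ?y"
    by (simp add: power2_eq_square mult_ac)
  moreover have "0 \<le> sigma_max A"
    unfolding sigma_max_def by (intro onorm_pos_le) simp
  ultimately show ?thesis
    by (cases "?y = 0") (auto intro: mult_right_le_imp_le)
qed

lemma linear_coeff_zero_if_quadratic_nonneg:
  fixes b c :: real
  assumes nonneg: "\<And>t. 0 \<le> b * t + c * t\<^sup>2"
  shows "b = 0"
proof -
  define a where "a = \<bar>c\<bar> + 1"
  have a: "a > 0" by (simp add: a_def)
  define t where "t = - b / a"
  have "b * t + c * t\<^sup>2 \<le> b * t + \<bar>c\<bar> * t\<^sup>2"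
    by (intro add_left_mono mult_right_mono) auto
  also have "\<dots> = - b\<^sup>2 / a\<^sup>2"
  proof -
    have abs_c: "\<bar>c\<bar> = a - 1" by (simp add: a_def)
    show ?thesis unfolding abs_c t_def using a by (simp add: field_simps power2_eq_square)
  qed
  finally have "b\<^sup>2 / a\<^sup>2 \<le> 0" using nonneg[of t] by linarith
  then show ?thesis using a by (simp add: divide_le_0_iff)
qed

lemma finite_eigenvalues_mat:
  fixes A :: "real^'n^'n"
  assumes "symmetric_mat A"
  shows "finite (eigenvalues_mat A)"
proof -
  let ?E = "eigenvalues_mat A"
  have "\<forall>l\<in>?E. \<exists>v. v \<noteq> 0 \<and> A *v v = l *\<^sub>R v" by (simp add: eigenvalues_mat_def)
  then obtain v where v: "\<And>l. l \<in> ?E \<Longrightarrow> v l \<noteq> 0 \<and> A *v v l = l *\<^sub>R v l" by metis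
  have "inj_on v ?E"
  proof (rule inj_onI)
    fix a b assume a: "a \<in> ?E" and "b \<in> ?E" "v a = v b"
    then have "a *\<^sub>R v a = b *\<^sub>R v a" using v by metis
    then show "a = b" using v[OF a] by (simp add: scaleR_cancel_right)
  qed
  moreover have "pairwise orthogonal (v ` ?E)"
  proof (clarsimp simp: pairwise_def)
    fix a b assume a: "a \<in> ?E" and b: "b \<in> ?E" and "v a \<noteq> v b"
    then have "a \<noteq> b" by auto
    have "a * (v a \<bullet> v b) = (A *v v a) \<bullet> v b" using v[OF a] by simp
    also have "\<dots> = v a \<bullet> (A *v v b)" by (rule symmetric_mat_inner_commute[OF assms])
    also have "\<dots> = b * (v a \<bullet> v b)" using v[OF b] by simp
    finally have "(a - b) * (v a \<bullet> v b) = 0" by (simp add: algebra_simps)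
    then show "orthogonal (v a) (v b)" using \<open>a \<noteq> b\<close> by (simp add: orthogonal_def)
  qed
  moreover have "0 \<notin> v ` ?E" using v by auto
  ultimately have "finite (v ` ?E)"
    using pairwise_orthogonal_independent independent_bound by blast
  then show ?thesis using \<open>inj_on v ?E\<close> finite_imageD by blast
qed

lemma psd_quadratic_form_eq_0_imp_mult_eq_0:
  fixes S :: "real^'n^'n"
  assumes "symmetric_mat S" and psd: "\<And>y. 0 \<le> y \<bullet> (S *v y)" and "x \<bullet> (S *v x) = 0"
  shows "S *v x = 0"
proof -
  let ?y = "S *v x"
  have "0 \<le> 2 * (?y \<bullet> ?y) * t + (?y \<bullet> (S *v ?y)) * t\<^sup>2" for t
  proof -
    have "x \<bullet> (S *v ?y) = ?y \<bullet> ?y"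
      using symmetric_mat_inner_commute[OF assms(1)] by metis
    then have "(x + t *\<^sub>R ?y) \<bullet> (S *v (x + t *\<^sub>R ?y))
        = 2 * (?y \<bullet> ?y) * t + (?y \<bullet> (S *v ?y)) * t\<^sup>2"
      using assms(3) by (simp add: matrix_vector_right_distrib matrix_vector_mult_scaleR
          inner_add_left inner_add_right inner_commute power2_eq_square algebra_simps)
    then show ?thesis using psd by metis
  qed
  then have "2 * (?y \<bullet> ?y) = 0" by (rule linear_coeff_zero_if_quadratic_nonneg)
  then show ?thesis by simp
qed

lemma symmetric_mat_ex_eigenvalue_le_quadratic_form:
  fixes A :: "real^'n^'n"
  assumes sym: "symmetric_mat A"
  shows "\<exists>m \<in> eigenvalues_mat A. \<forall>x. m * (norm x)\<^sup>2 \<le> x \<bullet> (A *v x)"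
proof -
  let ?f = "\<lambda>x. x \<bullet> (A *v x)"
  have "sphere (0::real^'n) 1 \<noteq> {}"
    using norm_axis_1 by (metis mem_sphere_0 empty_iff)
  moreover have "continuous_on (sphere 0 1) ?f" by (intro continuous_intros)
  ultimately obtain x0 where "x0 \<in> sphere 0 1" "\<forall>y \<in> sphere 0 1. ?f x0 \<le> ?f y"
    using continuous_attains_inf[OF compact_sphere] by blast
  then have x0: "norm x0 = 1" and min: "\<And>y. norm y = 1 \<Longrightarrow> ?f x0 \<le> ?f y" by auto
  \<comment> \<open>The minimum m on the sphere is an eigenvalue: A - m I is positive semidefinite
    and its quadratic form vanishes at the minimiser x0.\<close>
  define m where "m = ?f x0"
  have low: "m * (norm x)\<^sup>2 \<le> ?f x" for x
  proof (cases "x = 0")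
    case False
    have "m \<le> ?f ((1 / norm x) *\<^sub>R x)" unfolding m_def by (rule min) (use False in simp)
    also have "\<dots> = ?f x / (norm x)\<^sup>2"
      by (simp add: matrix_vector_mult_scaleR power2_eq_square)
    finally show ?thesis using False by (simp add: field_simps)
  qed simp
  define S where "S = A - m *\<^sub>R mat 1"
  have S_mult: "S *v y = A *v y - m *\<^sub>R y" for y
    by (simp add: S_def matrix_vector_mult_diff_rdistrib scaleR_matrix_vector_assoc[symmetric])
  have "symmetric_mat S"
    using sym by (auto simp: symmetric_mat_def S_def transpose_def vec_eq_iff mat_def)
  moreover have "0 \<le> y \<bullet> (S *v y)" for y
    using low[of y] by (simp add: S_mult inner_diff_right power2_norm_eq_inner)
  moreover have "x0 \<bullet> (S *v x0) = 0"
    using x0 by (simp add: S_mult inner_diff_right m_def power2_norm_eq_inner[symmetric])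
  ultimately have "S *v x0 = 0" by (rule psd_quadratic_form_eq_0_imp_mult_eq_0)
  then have "m \<in> eigenvalues_mat A"
    using x0 by (auto simp: eigenvalues_mat_def S_mult intro!: exI[of _ x0])
  then show ?thesis using low by blast
qed

lemma lambda_min_quadratic_form_le:
  fixes A :: "real^'n^'n"
  assumes "symmetric_mat A"
  shows "lambda_min A * (norm x)\<^sup>2 \<le> x \<bullet> (A *v x)"
proof -
  obtain m where "m \<in> eigenvalues_mat A" and m: "\<And>x. m * (norm x)\<^sup>2 \<le> x \<bullet> (A *v x)"
    using symmetric_mat_ex_eigenvalue_le_quadratic_form[OF assms] by blast
  then have "lambda_min A \<le> m"
    unfolding lambda_min_def using finite_eigenvalues_mat[OF assms] by simp
  then show ?thesis using m[of x] by (meson mult_right_mono order_trans zero_le_power2)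
qed

lemma tendsto_onorm_matrix_diff:
  fixes A :: "nat \<Rightarrow> real^'n^'m"
  assumes "A \<longlonglongrightarrow> A0"
  shows "(\<lambda>k. onorm ((*v) (A k - A0))) \<longlonglongrightarrow> 0"
proof (rule tendsto_sandwich)
  let ?E = "\<lambda>k. \<Sum>i\<in>UNIV. \<Sum>j\<in>UNIV. \<bar>(A k - A0) $ i $ j\<bar>"
  show "eventually (\<lambda>k. 0 \<le> onorm ((*v) (A k - A0))) sequentially"
    by (simp add: onorm_pos_le)
  show "eventually (\<lambda>k. onorm ((*v) (A k - A0)) \<le> ?E k) sequentially"
    by (intro always_eventually allI onorm_le_matrix_component_sum)
  have "?E \<longlonglongrightarrow> (\<Sum>i\<in>UNIV. \<Sum>j\<in>UNIV. \<bar>(A0 - A0) $ i $ j\<bar>)"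
    by (intro tendsto_intros assms)
  then show "?E \<longlonglongrightarrow> 0" by simp
qed simp

lemma eventually_quadratic_form_ge:
  fixes H :: "nat \<Rightarrow> real^'n^'n"
  assumes "H \<longlonglongrightarrow> H0" and H0: "\<And>x. m * (norm x)\<^sup>2 \<le> x \<bullet> (H0 *v x)" and "0 < e"
  shows "eventually (\<lambda>k. \<forall>x. (m - e) * (norm x)\<^sup>2 \<le> x \<bullet> (H k *v x)) sequentially"
  using order_tendstoD(2)[OF tendsto_onorm_matrix_diff[OF assms(1)] \<open>0 < e\<close>]
proof (rule eventually_mono, intro allI)
  fix k x
  let ?D = "H k - H0"
  assume "onorm ((*v) ?D) < e"
  have "norm (?D *v x) \<le> onorm ((*v) ?D) * norm x" by (rule onorm) simp
  also have "\<dots> \<le> e * norm x" using \<open>onorm ((*v) ?D) < e\<close> by (intro mult_right_mono) auto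
  finally have Dx: "norm (?D *v x) \<le> e * norm x" .
  have "\<bar>x \<bullet> (?D *v x)\<bar> \<le> norm x * norm (?D *v x)" by (rule Cauchy_Schwarz_ineq2)
  also have "\<dots> \<le> norm x * (e * norm x)" using Dx by (rule mult_left_mono) simp
  also have "\<dots> = e * (norm x)\<^sup>2" by (simp add: power2_eq_square)
  finally have "\<bar>x \<bullet> (?D *v x)\<bar> \<le> e * (norm x)\<^sup>2" .
  moreover have "x \<bullet> (H k *v x) = x \<bullet> (H0 *v x) + x \<bullet> (?D *v x)"
    by (simp add: matrix_vector_mult_diff_rdistrib inner_diff_right)
  ultimately show "(m - e) * (norm x)\<^sup>2 \<le> x \<bullet> (H k *v x)"
    using H0[of x] by (simp add: left_diff_distrib)
qed

lemma diag_mat_mult_axis: "diag_mat d *v axis j 1 = d $ j *\<^sub>R axis j (1::real)"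
proof -
  have "(diag_mat d *v axis j 1) $ i
      = (\<Sum>k\<in>UNIV. if k = j then (if i = j then d$i else 0) else 0)" for i
    unfolding diag_mat_def matrix_vector_mult_def axis_def vec_lambda_beta by (rule sum.cong) auto
  then show ?thesis by (simp add: vec_eq_iff axis_def)
qed

lemma orthogonal_conj_diag_mat_eigenvector:
  fixes Q :: "real^'n^'n"
  assumes "orthogonal_matrix Q"
  shows "(Q ** diag_mat d ** transpose Q) *v (Q *v axis j 1) = d $ j *\<^sub>R (Q *v axis j 1)"
proof -
  have QQ: "transpose Q ** Q = mat 1" using assms by (simp add: orthogonal_matrix_def)
  have "(Q ** diag_mat d ** transpose Q) *v (Q *v axis j 1)
      = Q *v (diag_mat d *v ((transpose Q ** Q) *v axis j 1))"
    by (simp only: matrix_vector_mul_assoc matrix_mul_assoc)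
  also have "\<dots> = Q *v (d $ j *\<^sub>R axis j 1)"
    by (simp only: QQ matrix_vector_mul_lid diag_mat_mult_axis)
  finally show ?thesis by (simp add: matrix_vector_mult_scaleR)
qed

lemma diag_entry_ge_if_congruence_coercive:
  fixes L P Q :: "real^('n::{finite,linorder})^('n::{finite,linorder})"
    and d :: "real^('n::{finite,linorder})"
  assumes L: "unit_lower_triangular L" and P: "orthogonal_matrix P" and Q: "orthogonal_matrix Q"
    and s: "sigma_max L \<le> s" and "0 \<le> c"
    and coercive: "\<And>z. c * (norm z)\<^sup>2
      \<le> z \<bullet> ((transpose P ** L ** (Q ** diag_mat d ** transpose Q) ** transpose L ** P) *v z)"
  shows "c / s\<^sup>2 \<le> d $ j"
proof -
  \<comment> \<open>Pull the unit eigenvector x of B back along the invertible map L^T P;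
    the preimage z has norm at least 1/s.\<close>
  define B where "B = Q ** diag_mat d ** transpose Q"
  define x where "x = Q *v axis j 1"
  have norm_x: "norm x = 1" using Q by (simp add: x_def orthogonal_matrix_norm)
  obtain y where y: "transpose L *v y = x"
    using surjD[OF unit_lower_triangular_transpose_surj[OF L], of x] by blast
  define z where "z = transpose P *v y"
  have "(transpose L ** P) *v z = transpose L *v ((P ** transpose P) *v y)"
    by (simp only: z_def matrix_vector_mul_assoc matrix_mul_assoc)
  also have "\<dots> = x" using P y by (simp only: orthogonal_matrix_def matrix_vector_mul_lid)
  finally have Mz: "(transpose L ** P) *v z = x" .
  have "norm z = norm y"
    using P by (simp add: z_def orthogonal_matrix_norm del: transpose_matrix_vector)
  have "1 = norm (transpose L *v y)" using y norm_x by simp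
  also have "\<dots> \<le> sigma_max L * norm y" by (rule norm_transpose_mult_le_sigma_max)
  also have "\<dots> \<le> s * norm z" using s \<open>norm z = norm y\<close> by (simp add: mult_right_mono)
  finally have "1 \<le> (s * norm z)\<^sup>2" by (simp add: one_le_power)
  then have "c * 1 \<le> c * (s\<^sup>2 * (norm z)\<^sup>2)"
    using \<open>0 \<le> c\<close> by (intro mult_left_mono) (simp_all add: power_mult_distrib)
  moreover have "0 < s\<^sup>2" using \<open>1 \<le> (s * norm z)\<^sup>2\<close> by (cases "s = 0") auto
  ultimately have "c / s\<^sup>2 \<le> c * (norm z)\<^sup>2" by (simp add: pos_divide_le_eq mult_ac)
  also have "\<dots> \<le> z \<bullet> ((transpose (transpose L ** P) ** B ** (transpose L ** P)) *v z)"
    using coercive[of z] by (simp add: B_def matrix_transpose_mul matrix_mul_assoc)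
  also have "\<dots> = x \<bullet> (B *v x)" by (simp only: inner_congruence Mz)
  also have "\<dots> = d $ j"
    using norm_x by (simp add: B_def x_def orthogonal_conj_diag_mat_eigenvector[OF Q]
        power2_norm_eq_inner[symmetric])
  finally show ?thesis .
qed

theorem theoremA3:
  fixes M :: "'w measure"
    and Hbar :: "nat \<Rightarrow> 'w \<Rightarrow> real^('p::{finite,linorder})^('p::{finite,linorder})"
    and P L B Q :: "nat \<Rightarrow> 'w \<Rightarrow> real^('p::{finite,linorder})^('p::{finite,linorder})"
    and lam :: "nat \<Rightarrow> 'w \<Rightarrow> real^('p::{finite,linorder})"
    and Hstar :: "real^('p::{finite,linorder})^('p::{finite,linorder})"
    and sigmabar tau :: real
  assumes "prob_space M"
    and sym: "\<And>k \<omega>. symmetric_mat (Hbar k \<omega>)"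
    and perm: "\<And>k \<omega>. permutation_mat (P k \<omega>)"
    and blk: "\<And>k \<omega>. block_diag_12 (B k \<omega>)"
    and lower: "\<And>k \<omega>. unit_lower_triangular (L k \<omega>)"
    and Lbdd: "\<exists>c. \<forall>k \<omega> i j. \<bar>L k \<omega> $ i $ j\<bar> \<le> c"
    and sigma: "\<And>k \<omega>. sigma_max (L k \<omega>) \<le> sigmabar"
    and fact: "\<And>k \<omega>. Hbar k \<omega> = transpose (P k \<omega>) ** L k \<omega> ** B k \<omega> ** transpose (L k \<omega>) ** P k \<omega>"
    and orth: "\<And>k \<omega>. orthogonal_matrix (Q k \<omega>)"
    and eig: "\<And>k \<omega>. B k \<omega> = Q k \<omega> ** diag_mat (lam k \<omega>) ** transpose (Q k \<omega>)"
    and conv: "AE \<omega> in M. (\<lambda>k. Hbar k \<omega>) \<longlonglongrightarrow> Hstar"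
    and pd: "positive_definite Hstar"
    and tau_pos: "0 < tau"
    and tau_le: "tau \<le> lambda_min Hstar / (2 * sigmabar\<^sup>2)"
  shows "AE \<omega> in M. \<exists>K1. \<forall>k>K1.
           transpose (P k \<omega>) ** L k \<omega> ** Q k \<omega>
             ** diag_mat (\<chi> j. max tau \<bar>lam k \<omega> $ j\<bar>)
             ** transpose (Q k \<omega>) ** transpose (L k \<omega>) ** P k \<omega>
           = Hbar k \<omega>"
proof -
  have "0 < lambda_min Hstar / (2 * sigmabar\<^sup>2)" using tau_pos tau_le by linarith
  then have lambda_pos: "0 < lambda_min Hstar" by (simp add: zero_less_divide_iff)
  have rayleigh: "\<And>x. lambda_min Hstar * (norm x)\<^sup>2 \<le> x \<bullet> (Hstar *v x)"
    using pd by (simp add: positive_definite_def lambda_min_quadratic_form_le)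
  show ?thesis using conv
  proof (rule eventually_mono, goal_cases)
    case (1 \<omega>)
    \<comment> \<open>Half of lambda_min is spent on the perturbation Hbar - Hstar: the factor 2 in the bound on tau.\<close>
    from eventually_quadratic_form_ge[OF 1 rayleigh, of "lambda_min Hstar / 2"] lambda_pos
    obtain K1 where coercive: "\<And>k x. K1 \<le> k \<Longrightarrow>
        lambda_min Hstar / 2 * (norm x)\<^sup>2 \<le> x \<bullet> (Hbar k \<omega> *v x)"
      by (auto simp: eventually_sequentially)
    have lam_ge: "tau \<le> lam k \<omega> $ j" if "K1 \<le> k" for k j
    proof -
      have "lambda_min Hstar / 2 / sigmabar\<^sup>2 \<le> lam k \<omega> $ j"
        using coercive[OF that] lambda_pos
        by (intro diag_entry_ge_if_congruence_coercive[OF lower[of k \<omega>]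
              permutation_mat_imp_orthogonal[OF perm[of k \<omega>]] orth[of k \<omega>] sigma])
          (simp_all flip: fact eig)
      then show ?thesis using tau_le by simp
    qed
    have "(\<chi> j. max tau \<bar>lam k \<omega> $ j\<bar>) = lam k \<omega>" if "K1 \<le> k" for k
    proof -
      have "max tau \<bar>lam k \<omega> $ j\<bar> = lam k \<omega> $ j" for j
        using lam_ge[OF that, of j] tau_pos by simp
      then show ?thesis by (simp add: vec_eq_iff)
    qed
    then show ?case by (intro exI[of _ K1] allI impI) (simp add: fact eig matrix_mul_assoc)
  qed
qed

end
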